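(* Let $D \subset \mathbb{C}$ be a convex domain and let $f : D \to \mathbb{C}$ be non-constant and analytic in $D$. If there exists a real number $c > 0$ such that $$|f'(z) - c| \leq c \quad \text{for all } z \in D,$$ then $f$ is univalent in $D$.
   Context: A domain is a nonempty connected open subset of $\mathbb{C}$. A function is univalent in a domain $D$ if it is analytic and injective in $D$. *)

theory Defs
  imports "HOL-Complex_Analysis.Complex_Analysis"
begin

definition domain_set :: "complex set \<Rightarrow> bool" where
  "domain_set D \<longleftrightarrow> D \<noteq> {} \<and> open D \<and> connected D"

definition univalent_on :: "(complex \<Rightarrow> complex) \<Rightarrow> complex set \<Rightarrow> bool"  (infixl "univalent'_on" 50) where
  "f univalent_on D \<longleftrightarrow> f analytic_on D \<and> inj_on f D"

end

theory Submission
  imports Defs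
begin

text \<open>The disc condition forces \<open>Re f' \<ge> 0\<close>, with equality only where \<open>f' = 0\<close>. If \<open>f a = f b\<close> with
  \<open>a \<noteq> b\<close>, then \<open>Re (f / (b - a))\<close> is nondecreasing along the segment from \<open>a\<close> to \<open>b\<close> and takes
  equal values at its ends, so it is constant there. Hence \<open>f' = 0\<close> on the segment, and the identity
  theorem makes \<open>f\<close> constant.\<close>

lemma Re_nonneg_if_norm_diff_le:
  assumes "norm (w - of_real c) \<le> c"
  shows "0 \<le> Re w"
  using abs_Re_le_cmod[of "w - of_real c"] assms by simp

text \<open>The closed disc of radius \<open>c\<close> about \<open>c\<close> touches the imaginary
  axis only at the origin: when \<open>Re w = 0\<close>, squaring the bound gives
  \<open>c^2 + (Im w)^2 \<le> c^2\<close>.\<close>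

lemma eq_0_if_norm_diff_le:
  assumes "norm (w - of_real c) \<le> c" "Re w = 0"
  shows "w = 0"
proof -
  have "0 \<le> c" using assms(1) norm_ge_zero order_trans by blast
  then have "(norm (w - of_real c))\<^sup>2 \<le> c\<^sup>2" using assms(1) by (intro power_mono) auto
  then have "Im w = 0" using assms(2) by (simp add: cmod_power2)
  then show ?thesis using assms(2) by (simp add: complex_eq_iff)
qed

lemma Re_deriv_eq_0_on_open_segment:
  fixes f :: "complex \<Rightarrow> complex"
  assumes "f holomorphic_on D" "open D" "convex D"
    and nonneg: "\<And>z. z \<in> D \<Longrightarrow> 0 \<le> Re (deriv f z)"
    and "a \<in> D" "b \<in> D" "a \<noteq> b" "f a = f b" "z \<in> open_segment a b"
  shows "Re (deriv f z) = 0"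
proof -
  define p where "p t = a + of_real t * (b - a)" for t
  \<comment> \<open>Dividing by \<open>b - a\<close> cancels the chain rule factor
    \<open>p' = b - a\<close>, so the derivative of \<open>h\<close> is exactly
    \<open>Re (deriv f (p t))\<close>, whose sign is known.\<close>
  define h where "h t = Re (f (p t) / (b - a))" for t
  have p_in: "p t \<in> D" if "0 \<le> t" "t \<le> 1" for t
    using convexD_alt[OF assms(3,5,6) that]
    by (simp add: p_def scaleR_conv_of_real algebra_simps)
  have h_deriv: "(h has_real_derivative Re (deriv f (p t))) (at t)" if "0 \<le> t" "t \<le> 1" for t
  proof -
    have "(f has_field_derivative deriv f (p t)) (at (p t))"
      using assms(1,2) p_in[OF that] by (rule holomorphic_derivI)
    moreover have "(p has_vector_derivative (b - a)) (at t)"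
      unfolding p_def by (auto intro!: derivative_eq_intros)
    ultimately have "((f \<circ> p) has_vector_derivative ((b - a) * deriv f (p t))) (at t)"
      by (intro field_vector_diff_chain_at)
    from has_vector_derivative_divide[OF this, of "b - a"]
    have "((\<lambda>t. (f \<circ> p) t / (b - a)) has_vector_derivative deriv f (p t)) (at t)"
      using assms(7) by simp
    from has_field_derivative_Re[OF this] show ?thesis
      by (simp add: h_def[abs_def])
  qed
  have h_mono: "h s \<le> h t" if "0 \<le> s" "s \<le> t" "t \<le> 1" for s t
    using that(2)
  proof (rule DERIV_nonneg_imp_nondecreasing)
    fix x assume "s \<le> x" "x \<le> t"
    then have "0 \<le> x" "x \<le> 1" using that by auto
    then show "\<exists>y. (h has_real_derivative y) (at x) \<and> 0 \<le> y"
      using h_deriv nonneg p_in by blast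
  qed
  have "h 0 = h 1" using assms(8) by (simp add: h_def p_def)
  \<comment> \<open>Monotonicity squeezes \<open>h t\<close> between the equal values
    \<open>h 0\<close> and \<open>h 1\<close>.\<close>
  then have h_const: "h t = h 0" if "0 \<le> t" "t \<le> 1" for t
    using h_mono[of 0 t] h_mono[of t 1] that by simp
  obtain t where t: "0 < t" "t < 1" "z = p t"
    using assms(9) by (auto simp: in_segment p_def scaleR_conv_of_real algebra_simps)
  \<comment> \<open>Since \<open>z\<close> is not an endpoint, \<open>h\<close> is constant on a
    whole neighbourhood of \<open>t\<close>, so its two-sided derivative there is 0. Uniqueness of
    derivatives then identifies \<open>Re (deriv f z)\<close> with 0.\<close>
  have "(h has_real_derivative 0) (at t)"
  proof (rule has_field_derivative_transform_within_open[OF DERIV_const])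
    show "open {0<..<1::real}" "t \<in> {0<..<1}" using t by auto
    show "h 0 = h s" if "s \<in> {0<..<1}" for s using h_const[of s] that by simp
  qed
  moreover have "(h has_real_derivative Re (deriv f z)) (at t)"
    using h_deriv[of t] t by simp
  ultimately show ?thesis using DERIV_unique by blast
qed

text \<open>Supplies the accumulation point for the identity theorem: a connected set with more than
  one point has no isolated points.\<close>

lemma islimpt_open_segment_midpoint:
  fixes a b :: "'a::euclidean_space"
  assumes "a \<noteq> b"
  shows "midpoint a b islimpt open_segment a b"
proof (rule connected_imp_perfect)
  show "connected (open_segment a b)" by (simp add: convex_connected)
  show "midpoint a b \<in> open_segment a b" using assms by simp
  show "open_segment a b \<noteq> {x}" for x
    using assms by (simp add: open_segment_eq_sing)
qed

theorem corollary2p6: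
  fixes D :: "complex set" and f :: "complex \<Rightarrow> complex"
  assumes "domain_set D" and "convex D"
    and "f analytic_on D" and "\<not> f constant_on D"
    and "\<exists>c::real. c > 0 \<and> (\<forall>z\<in>D. norm (deriv f z - of_real c) \<le> c)"
  shows "f univalent_on D"
proof -
  obtain c :: real where c: "\<And>z. z \<in> D \<Longrightarrow> norm (deriv f z - of_real c) \<le> c"
    using assms(5) by blast
  have D: "open D" "connected D" using assms(1) by (auto simp: domain_set_def)
  have hol: "f holomorphic_on D" using assms(3) by (rule analytic_imp_holomorphic)
  have "a = b" if ab: "a \<in> D" "b \<in> D" "f a = f b" for a b
  proof (rule ccontr)
    assume "a \<noteq> b"
    have seg: "closed_segment a b \<subseteq> D"
      using assms(2) ab by (simp add: closed_segment_subset)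
    then have sub: "open_segment a b \<subseteq> D"
      using segment_open_subset_closed by blast
    have zero: "deriv f z = 0" if "z \<in> open_segment a b" for z
    proof (rule eq_0_if_norm_diff_le)
      show "norm (deriv f z - of_real c) \<le> c" using c sub that by auto
      show "Re (deriv f z) = 0"
        using hol D(1) assms(2) Re_nonneg_if_norm_diff_le[OF c] ab(1,2) \<open>a \<noteq> b\<close> ab(3) that
        by (rule Re_deriv_eq_0_on_open_segment)
    qed
    have "midpoint a b \<in> D" using seg by auto
    \<comment> \<open>The identity theorem is applied to \<open>deriv f\<close> rather than to
      \<open>f\<close>: its zeros on the open segment accumulate at the midpoint, which lies in
      \<open>D\<close>, so \<open>deriv f\<close> vanishes on all of \<open>D\<close>.\<close>
    note analytic_continuation[OF holomorphic_deriv[OF hol D(1)] D sub this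
        islimpt_open_segment_midpoint[OF \<open>a \<noteq> b\<close>] zero]
    then have "(f has_field_derivative 0) (at z)" if "z \<in> D" for z
      using holomorphic_derivI[OF hol D(1) that] that by simp
    then have "f constant_on D"
      using has_field_derivative_0_imp_constant_on D by blast
    with assms(4) show False by contradiction
  qed
  then show ?thesis
    using assms(3) by (auto simp: univalent_on_def inj_on_def)
qed

end
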